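(* Let $k\geq1$ be an integer and let $B=\mathbb{C}[x]/(x^2)$, graded with $\deg x=1$. The tensor associated to the bilinear multiplication map $$(B^{\otimes 3k})_k\times(B^{\otimes 3k})_k\to(B^{\otimes 3k})_{2k}$$ has rank at most $$\frac12\,8^k-\sum_{i=k+1}^{\lfloor3k/2\rfloor}\binom{3k}{2i}.$$
   Context: The subscript denotes the graded piece for the total grading on $B^{\otimes3k}=\mathbb{C}[x_1,\ldots,x_{3k}]/(x_1^2,\ldots,x_{3k}^2)$. A bilinear map $U\times V\to W$ corresponds to a tensor in $U^*\otimes V^*\otimes W$; its rank is the least number of tensors $u\otimes v\otimes w$ summing to it. *)

theory Defs
  imports
    Complex_Main
    "HOL-Library.Poly_Mapping"
    "HOL-Library.Extended_Nat"
    "HOL-Library.Extended_Real"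
    "HOL-Algebra.QuotRing"
    "HOL-Algebra.Module"
begin

section \<open>Tensor rank of a bilinear map\<close>

definition complex_field :: "complex ring" where
  "complex_field = \<lparr>carrier = UNIV, mult = (*), one = 1, zero = 0, add = (+)\<rparr>"

text \<open>
  Vector spaces over the complex numbers are modules over \<^const>\<open>complex_field\<close>.  Linear forms and
  bilinear maps are HOL functions of which only the values on the carriers matter.
\<close>

definition linear_form :: "(complex, 'u) module \<Rightarrow> ('u \<Rightarrow> complex) \<Rightarrow> bool" where
  "linear_form U u \<longleftrightarrow>
     (\<forall>x\<in>carrier U. \<forall>y\<in>carrier U. u (x \<oplus>\<^bsub>U\<^esub> y) = u x + u y) \<and>
     (\<forall>c. \<forall>x\<in>carrier U. u (c \<odot>\<^bsub>U\<^esub> x) = c * u x)"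

text \<open>
  The tensor \<open>u \<otimes> v \<otimes> w\<close> in \<open>U\<^sup>* \<otimes> V\<^sup>* \<otimes> W\<close>, under the identification of this space with the
  bilinear maps \<open>U \<times> V \<rightarrow> W\<close> (for finite-dimensional \<open>U\<close>, \<open>V\<close>).
\<close>

definition simple_tensor ::
  "(complex, 'w) module \<Rightarrow> ('u \<Rightarrow> complex) \<Rightarrow> ('v \<Rightarrow> complex) \<Rightarrow> 'w \<Rightarrow> 'u \<Rightarrow> 'v \<Rightarrow> 'w" where
  "simple_tensor W u v w = (\<lambda>x y. (u x * v y) \<odot>\<^bsub>W\<^esub> w)"

definition is_tensor_decomposition ::
  "(complex, 'u) module \<Rightarrow> (complex, 'v) module \<Rightarrow> (complex, 'w) module \<Rightarrow> ('u \<Rightarrow> 'v \<Rightarrow> 'w) \<Rightarrow>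
     nat \<Rightarrow> (nat \<Rightarrow> 'u \<Rightarrow> complex) \<Rightarrow> (nat \<Rightarrow> 'v \<Rightarrow> complex) \<Rightarrow> (nat \<Rightarrow> 'w) \<Rightarrow> bool" where
  "is_tensor_decomposition U V W f r u v w \<longleftrightarrow>
     (\<forall>j<r. linear_form U (u j) \<and> linear_form V (v j) \<and> w j \<in> carrier W) \<and>
     (\<forall>x\<in>carrier U. \<forall>y\<in>carrier V.
        f x y = (\<Oplus>\<^bsub>W\<^esub>j\<in>{..<r}. simple_tensor W (u j) (v j) (w j) x y))"

text \<open>
  The value is \<open>\<infinity>\<close> if there is no decomposition at all, so that an upper bound on the rank also
  asserts the existence of a decomposition.
\<close>

definition tensor_rank ::
  "(complex, 'u) module \<Rightarrow> (complex, 'v) module \<Rightarrow> (complex, 'w) module \<Rightarrow> ('u \<Rightarrow> 'v \<Rightarrow> 'w) \<Rightarrow> enat"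
  where
  "tensor_rank U V W f = Inf {enat r |r. \<exists>u v w. is_tensor_decomposition U V W f r u v w}"


section \<open>The algebra \<open>\<complex>[x\<^sub>1, \<dots>, x\<^sub>n] / (x\<^sub>1\<^sup>2, \<dots>, x\<^sub>n\<^sup>2)\<close>\<close>

text \<open>
  A monomial is the finitely supported function from indices of variables to exponents, and a
  polynomial is the finitely supported function from monomials to coefficients; the product of
  \<^typ>\<open>(nat \<Rightarrow>\<^sub>0 nat) \<Rightarrow>\<^sub>0 complex\<close> is convolution.
\<close>

type_synonym cpoly = "(nat \<Rightarrow>\<^sub>0 nat) \<Rightarrow>\<^sub>0 complex"

definition poly_var :: "nat \<Rightarrow> cpoly" where
  "poly_var i = Poly_Mapping.single (Poly_Mapping.single i 1) 1"

definition poly_const :: "complex \<Rightarrow> cpoly" where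
  "poly_const c = Poly_Mapping.single 0 c"

definition poly_ring :: "nat \<Rightarrow> cpoly ring" where
  "poly_ring n =
     \<lparr>carrier = {p. \<forall>m\<in>Poly_Mapping.keys p. Poly_Mapping.keys m \<subseteq> {1..n}},
      mult = (*), one = 1, zero = 0, add = (+)\<rparr>"

definition square_ideal :: "nat \<Rightarrow> cpoly set" where
  "square_ideal n = Idl\<^bsub>poly_ring n\<^esub> ((\<lambda>i. poly_var i ^ 2) ` {1..n})"

text \<open>
  This is the \<open>n\<close>-fold tensor power of \<open>\<complex>[x] / (x\<^sup>2)\<close>.  The scalar \<open>c\<close> acts as multiplication by
  the class of the constant polynomial \<open>c\<close>.
\<close>

definition tensor_power_B :: "nat \<Rightarrow> (complex, cpoly set) module" where
  "tensor_power_B n =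
     (let Q = poly_ring n Quot square_ideal n in
      ring.extend Q (module.fields
        (\<lambda>c X. (square_ideal n +>\<^bsub>poly_ring n\<^esub> poly_const c) \<otimes>\<^bsub>Q\<^esub> X)))"

definition homogeneous :: "nat \<Rightarrow> cpoly \<Rightarrow> bool" where
  "homogeneous d p \<longleftrightarrow>
     (\<forall>m\<in>Poly_Mapping.keys p. (\<Sum>i\<in>Poly_Mapping.keys m. Poly_Mapping.lookup m i) = d)"

definition graded_piece :: "nat \<Rightarrow> nat \<Rightarrow> (complex, cpoly set) module" where
  "graded_piece n d = (tensor_power_B n)
     \<lparr>carrier := {square_ideal n +>\<^bsub>poly_ring n\<^esub> p |p. p \<in> carrier (poly_ring n) \<and> homogeneous d p}\<rparr>"

end

(*
  Replacing x_i^2 = 0 by x_i^2 = 1 turns the algebra into the group algebra of (Z/2)^n, where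
  x^S x^T = x^(S + T) with S + T the symmetric difference.  If |S| = |T| = k and |C| = 2k, then
  S + T = C exactly when C is the disjoint union of S and T, so the coefficients of degree 2k of
  the two products agree.  The product in the group algebra is diagonalised by the 2^n characters.
  Only even subsets of size at most 2k occur as S + T, so evaluation at as many characters as there
  are such subsets already determines the product; for n = 3k their number is the claimed bound.
*)
theory Submission
  imports Defs
begin

section \<open>Row rank is at most the number of columns\<close>

text \<open>Gaussian elimination, one column of \<open>I\<close> at a time: a new column
  \<open>a\<close> either is already matched by the combinations found so far, or one row with a
  nonzero residual there serves as pivot and joins \<open>Q\<close>. Each column thus costs at most
  one row.\<close>

lemma spanning_subfamily:
  fixes g :: "'p \<Rightarrow> 'i \<Rightarrow> 'a::field"
  assumes "finite I" "finite P"
  shows "\<exists>Q\<subseteq>P. card Q \<le> card I \<and> (\<exists>c. \<forall>p\<in>P. \<forall>i\<in>I. g p i = (\<Sum>q\<in>Q. c p q * g q i))"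
  using assms(1)
proof (induction I)
  case empty
  show ?case by (rule exI[of _ "{}"]) simp
next
  case (insert a I)
  obtain Q c where Q: "Q \<subseteq> P" "card Q \<le> card I"
    and c: "\<forall>p\<in>P. \<forall>i\<in>I. g p i = (\<Sum>q\<in>Q. c p q * g q i)"
    using insert.IH by auto
  have fQ: "finite Q" using Q(1) assms(2) finite_subset by blast
  \<comment> \<open>The residual of row \<open>p\<close>; it vanishes on the old columns
    \<open>I\<close>, so only its value at \<open>a\<close> needs repair.\<close>
  define h where "h p i = g p i - (\<Sum>q\<in>Q. c p q * g q i)" for p i
  show ?case
  proof (cases "\<forall>p\<in>P. h p a = 0")
    case True
    then show ?thesis
      using Q c insert.hyps
      by (intro exI[of _ Q] conjI exI[of _ c]) (auto simp: h_def)
  next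
    case False
    then obtain p0 where p0: "p0 \<in> P" "h p0 a \<noteq> 0" by auto
    \<comment> \<open>These coefficients add \<open>h p a / h p0 a\<close> times the residual row of
      \<open>p0\<close> to the old combination. The two cases are added rather than made exclusive
      because \<open>p0\<close> may already lie in \<open>Q\<close>.\<close>
    define d where "d p q = (if q \<in> Q then c p q - h p a / h p0 a * c p0 q else 0)
      + (if q = p0 then h p a / h p0 a else 0)" for p q
    have sum_d: "(\<Sum>q\<in>insert p0 Q. d p q * g q i)
        = (\<Sum>q\<in>Q. c p q * g q i) + h p a / h p0 a * h p0 i" for p i
    proof -
      have "(\<Sum>q\<in>insert p0 Q. d p q * g q i) =
          (\<Sum>q\<in>insert p0 Q. if q \<in> Q then (c p q - h p a / h p0 a * c p0 q) * g q i else 0)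
          + (\<Sum>q\<in>insert p0 Q. if q = p0 then h p a / h p0 a * g p0 i else 0)"
        unfolding sum.distrib[symmetric] by (intro sum.cong) (auto simp: d_def algebra_simps)
      also have "(\<Sum>q\<in>insert p0 Q. if q = p0 then h p a / h p0 a * g p0 i else 0) = h p a / h p0 a * g p0 i"
        using fQ by simp
      also have "(\<Sum>q\<in>insert p0 Q. if q \<in> Q then (c p q - h p a / h p0 a * c p0 q) * g q i else 0)
          = (\<Sum>q\<in>Q. (c p q - h p a / h p0 a * c p0 q) * g q i)"
        using fQ by (intro sum.mono_neutral_cong_right) auto
      finally show ?thesis
        by (simp add: h_def left_diff_distrib right_diff_distrib sum_subtractf sum_distrib_left mult.assoc)
    qed
    have "g p i = (\<Sum>q\<in>insert p0 Q. d p q * g q i)" if "p \<in> P" "i \<in> insert a I" for p i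
    proof (cases "i = a")
      case True
      then show ?thesis using p0(2) by (simp add: sum_d) (simp add: h_def)
    next
      case False
      then have "h p0 i = 0" "g p i = (\<Sum>q\<in>Q. c p q * g q i)" using that p0(1) c by (auto simp: h_def)
      then show ?thesis by (simp add: sum_d)
    qed
    moreover have "card (insert p0 Q) \<le> card (insert a I)"
      using Q(2) fQ insert.hyps by (simp add: card_insert_if)
    moreover have "insert p0 Q \<subseteq> P" using Q p0 by auto
    ultimately show ?thesis by blast
  qed
qed

section \<open>Characters of the group of subsets under symmetric difference\<close>

text \<open>For finite \<open>P\<close> this is (-1) to the power |A \<inter> P|: the character
  indexed by \<open>P\<close>, evaluated at the group element \<open>A\<close>.\<close>

definition character :: "nat set \<Rightarrow> nat set \<Rightarrow> complex" where
  "character A P = (\<Prod>i\<in>P. if i \<in> A then -1 else 1)"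

lemma character_mult: "character A P * character B P = character (sym_diff A B) P"
  unfolding character_def prod.distrib[symmetric] by (rule prod.cong) auto

text \<open>The sum over all subsets of \<open>N\<close> factors into a product over
  \<open>N\<close> of (sign + 1), and every element of \<open>D\<close> contributes a factor
  0.\<close>

lemma sum_character:
  assumes "finite N" "D \<subseteq> N" "D \<noteq> {}"
  shows "(\<Sum>P\<in>Pow N. character D P) = 0"
proof -
  have "(\<Sum>P\<in>Pow N. character D P) = (\<Prod>i\<in>N. (if i \<in> D then -1 else 1) + 1)"
    using assms(1) by (subst prod_add) (simp_all add: character_def)
  also have "\<dots> = 0" using assms by (intro prod_zero) auto
  finally show ?thesis .
qed

lemma character_orthogonality:
  assumes "finite N" "A \<subseteq> N" "B \<subseteq> N"
  shows "(\<Sum>P\<in>Pow N. character A P * character B P) = (if A = B then 2 ^ card N else 0)"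
proof (cases "A = B")
  case True
  then show ?thesis
    by (simp add: character_mult card_Pow assms(1) character_def[of "{}"])
next
  case False
  then show ?thesis
    using sum_character[OF assms(1), of "sym_diff A B"] assms by (auto simp: character_mult)
qed

section \<open>Even subsets: extraction of coefficients and counting\<close>

definition even_subsets :: "nat \<Rightarrow> nat \<Rightarrow> nat set set" where
  "even_subsets n k = {A. A \<subseteq> {1..n} \<and> even (card A) \<and> card A \<le> 2 * k}"

lemma finite_even_subsets: "finite (even_subsets n k)"
  unfolding even_subsets_def by (rule finite_subset[of _ "Pow {1..n}"]) auto

lemma card_even_subsets: "card (even_subsets n k) = (\<Sum>i\<le>k. n choose (2 * i))"
proof -
  have "even_subsets n k = (\<Union>i\<in>{..k}. {A. A \<subseteq> {1..n} \<and> card A = 2 * i})"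
    by (auto simp: even_subsets_def elim!: evenE)
  also have "card \<dots> = (\<Sum>i\<le>k. card {A. A \<subseteq> {1..n} \<and> card A = 2 * i})"
  proof (rule card_UN_disjoint)
    show "\<forall>i\<in>{..k}. finite {A. A \<subseteq> {1..n} \<and> card A = 2 * i}"
      by (auto intro: finite_subset[of _ "Pow {1..n}"])
  qed auto
  also have "\<dots> = (\<Sum>i\<le>k. n choose (2 * i))"
    by (simp add: n_subsets)
  finally show ?thesis .
qed

text \<open>Fourier inversion with few characters. An element of the group algebra supported on
  \<open>even_subsets n k\<close> is recovered from its values at the characters \<open>e j\<close>;
  the numbers \<open>w j B\<close> are the weights that yield its coefficient at \<open>B\<close>.
  Inversion over all subsets of {1..n} is reduced to the characters in a spanning subfamily.\<close>

lemma coefficient_extraction: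
  "\<exists>r e w. r \<le> (\<Sum>i\<le>k. n choose (2 * i)) \<and>
     (\<forall>A\<in>even_subsets n k. \<forall>B\<in>even_subsets n k.
        (\<Sum>j<r. character A (e j) * w j B) = (if A = B then 1 else 0))"
proof -
  obtain Q c where Q: "Q \<subseteq> Pow {1..n}" "card Q \<le> card (even_subsets n k)"
    and c: "\<forall>P\<in>Pow {1..n}. \<forall>A\<in>even_subsets n k. character A P = (\<Sum>q\<in>Q. c P q * character A q)"
    using spanning_subfamily[OF finite_even_subsets, of "Pow {1..n}" n k "\<lambda>P A. character A P"] by auto
  have fQ: "finite Q" using Q(1) finite_subset by blast
  obtain e where e: "bij_betw e {..<card Q} Q"
    using ex_bij_betw_nat_finite[OF fQ] by (auto simp: atLeast0LessThan)
  \<comment> \<open>Obtained by substituting the expansion \<open>c\<close> of every character into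
    the inversion formula and collecting the factor that belongs to \<open>q\<close>.\<close>
  define v where "v q B = (\<Sum>P\<in>Pow {1..n}. c P q * character B P) / 2 ^ n" for q B
  have "(\<Sum>j<card Q. character A (e j) * v (e j) B) = (if A = B then 1 else 0)"
    if A: "A \<in> even_subsets n k" and B: "B \<in> even_subsets n k" for A B
  proof -
    have "(\<Sum>j<card Q. character A (e j) * v (e j) B) = (\<Sum>q\<in>Q. character A q * v q B)"
      by (rule sum.reindex_bij_betw[OF e])
    also have "\<dots> = (\<Sum>q\<in>Q. \<Sum>P\<in>Pow {1..n}. c P q * character A q * character B P) / 2 ^ n"
      by (simp add: v_def sum_distrib_left sum_divide_distrib mult_ac)
    also have "\<dots> = (\<Sum>P\<in>Pow {1..n}. (\<Sum>q\<in>Q. c P q * character A q) * character B P) / 2 ^ n"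
      by (subst sum.swap) (simp add: sum_distrib_right)
    also have "\<dots> = (\<Sum>P\<in>Pow {1..n}. character A P * character B P) / 2 ^ n"
      using c A by (intro arg_cong2[of _ _ _ _ "(/)"] sum.cong) auto
    also have "\<dots> = (if A = B then 1 else 0)"
      using A B by (subst character_orthogonality) (auto simp: even_subsets_def)
    finally show ?thesis .
  qed
  with Q(2) show ?thesis
    by (intro exI[of _ "card Q"] exI[of _ e] exI[of _ "\<lambda>j. v (e j)"]) (simp add: card_even_subsets)
qed

text \<open>The even binomial coefficients of 3k make up half of 2^(3k) = 8^k; the terms with i > k
  are split off. Positivity of 3k enters through \<open>choose_even_sum\<close>.\<close>

lemma sum_choose_even:
  assumes "k \<ge> 1"
  shows "real (\<Sum>i\<le>k. (3 * k) choose (2 * i))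
    = 1 / 2 * 8 ^ k - (\<Sum>i = k + 1..(3 * k) div 2. real ((3 * k) choose (2 * i)))"
proof -
  let ?n = "3 * k"
  have "(\<Sum>i\<le>?n. if even i then real (?n choose i) else 0)
      = (\<Sum>i\<in>(*) 2 ` {..?n div 2}. real (?n choose i))"
    by (rule sum.mono_neutral_cong_right) (auto simp: image_iff elim!: evenE)
  also have "\<dots> = (\<Sum>i\<le>?n div 2. real (?n choose (2 * i)))"
    by (subst sum.reindex) (auto simp: inj_on_def)
  also have "{..?n div 2} = {..k} \<union> {k + 1..?n div 2}" using assms by auto
  also have "(\<Sum>i\<in>\<dots>. real (?n choose (2 * i))) =
      (\<Sum>i\<le>k. real (?n choose (2 * i))) + (\<Sum>i = k + 1..?n div 2. real (?n choose (2 * i)))"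
    by (rule sum.union_disjoint) auto
  finally have "2 * \<dots> = 2 ^ ?n" using choose_even_sum[of ?n, where 'a = real] assms by simp
  moreover have "(2::real) ^ ?n = 8 ^ k" by (simp add: power_mult)
  ultimately show ?thesis by simp
qed

section \<open>Squarefree monomials and their coefficients\<close>

text \<open>The exponent vector of x^S; adding exponent vectors multiplies monomials.\<close>

definition squarefree_monomial :: "nat set \<Rightarrow> nat \<Rightarrow>\<^sub>0 nat" where
  "squarefree_monomial S = (\<Sum>i\<in>S. Poly_Mapping.single i 1)"

abbreviation squarefree_coeff :: "cpoly \<Rightarrow> nat set \<Rightarrow> complex" where
  "squarefree_coeff p S \<equiv> Poly_Mapping.lookup p (squarefree_monomial S)"

lemma lookup_squarefree_monomial:
  assumes "finite S"
  shows "Poly_Mapping.lookup (squarefree_monomial S) i = (if i \<in> S then 1 else 0)"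
proof -
  have "Poly_Mapping.lookup (squarefree_monomial S) i = (\<Sum>j\<in>S. if j = i then 1 else 0)"
    by (simp add: squarefree_monomial_def lookup_sum lookup_single when_def del: One_nat_def)
  then show ?thesis using assms by simp
qed

lemma keys_squarefree_monomial: "finite S \<Longrightarrow> Poly_Mapping.keys (squarefree_monomial S) = S"
  by (auto simp: in_keys_iff lookup_squarefree_monomial split: if_splits)

lemma squarefree_monomial_eq_iff:
  "finite S \<Longrightarrow> finite T \<Longrightarrow> squarefree_monomial S = squarefree_monomial T \<longleftrightarrow> S = T"
  by (metis keys_squarefree_monomial)

lemma squarefree_monomialI:
  assumes "\<And>i. Poly_Mapping.lookup m i \<le> 1"
  shows "m = squarefree_monomial (Poly_Mapping.keys m)"
proof (rule poly_mapping_eqI)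
  fix i
  show "Poly_Mapping.lookup m i = Poly_Mapping.lookup (squarefree_monomial (Poly_Mapping.keys m)) i"
    using assms[of i] by (auto simp: lookup_squarefree_monomial in_keys_iff)
qed

text \<open>At each variable the two exponents add up to 0 or 1, so both factors of x^C are
  squarefree and their supports partition \<open>C\<close>.\<close>

lemma squarefree_monomial_eq_add_iff:
  assumes "finite C"
  shows "squarefree_monomial C = l + m \<longleftrightarrow>
    (\<exists>S\<subseteq>C. l = squarefree_monomial S \<and> m = squarefree_monomial (C - S))"
proof
  assume eq: "squarefree_monomial C = l + m"
  have lm: "Poly_Mapping.lookup l i + Poly_Mapping.lookup m i = (if i \<in> C then 1 else 0)" for i
    using arg_cong[OF eq, of "\<lambda>m. Poly_Mapping.lookup m i"] assms
    by (simp add: lookup_add lookup_squarefree_monomial)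
  have l: "Poly_Mapping.lookup l i \<le> 1" and m: "Poly_Mapping.lookup m i \<le> 1" for i
    using lm[of i] by (auto split: if_splits)
  have sub: "Poly_Mapping.keys l \<subseteq> C"
  proof
    fix i assume "i \<in> Poly_Mapping.keys l"
    then show "i \<in> C" using lm[of i] by (auto simp: in_keys_iff split: if_splits)
  qed
  moreover have "Poly_Mapping.keys m = C - Poly_Mapping.keys l"
  proof (rule Set.set_eqI)
    fix i show "i \<in> Poly_Mapping.keys m \<longleftrightarrow> i \<in> C - Poly_Mapping.keys l"
      using lm[of i] by (auto simp: in_keys_iff split: if_splits)
  qed
  ultimately show "\<exists>S\<subseteq>C. l = squarefree_monomial S \<and> m = squarefree_monomial (C - S)"
    using squarefree_monomialI[OF l] squarefree_monomialI[OF m] by metis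
next
  assume "\<exists>S\<subseteq>C. l = squarefree_monomial S \<and> m = squarefree_monomial (C - S)"
  then obtain S where S: "S \<subseteq> C" "l = squarefree_monomial S" "m = squarefree_monomial (C - S)" by auto
  show "squarefree_monomial C = l + m"
    unfolding S(2,3) squarefree_monomial_def sum.subset_diff[OF S(1) assms] by (rule add.commute)
qed

text \<open>Since all divisors of x^C are squarefree, the squarefree coefficients of a product
  depend only on those of the factors. This makes the kernel below an ideal.\<close>

lemma squarefree_coeff_mult:
  assumes "finite C"
  shows "squarefree_coeff (p * q) C = (\<Sum>S\<in>Pow C. squarefree_coeff p S * squarefree_coeff q (C - S))"
proof -
  \<comment> \<open>The inner sum of the convolution: the coefficient of \<open>q\<close> at the
    cofactor of \<open>l\<close> in x^C, or 0 if \<open>l\<close> does not divide x^C.\<close>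
  define g where "g l = (\<Sum>m. Poly_Mapping.lookup q m when squarefree_monomial C = l + m)" for l
  have inj: "inj_on squarefree_monomial (Pow C)"
    using assms by (intro inj_onI) (metis PowD finite_subset squarefree_monomial_eq_iff)
  have g0: "g l = 0" if "l \<notin> squarefree_monomial ` Pow C" for l
  proof -
    have "squarefree_monomial C \<noteq> l + m" for m
      using that squarefree_monomial_eq_add_iff[OF assms, of l m] by auto
    then show ?thesis by (simp add: g_def)
  qed
  have g1: "g (squarefree_monomial S) = squarefree_coeff q (C - S)" if "S \<subseteq> C" for S
  proof -
    have "squarefree_monomial C = squarefree_monomial S + squarefree_monomial (C - S)"
      using squarefree_monomial_eq_add_iff[OF assms] that by blast
    then have "squarefree_monomial C = squarefree_monomial S + m \<longleftrightarrow> m = squarefree_monomial (C - S)" for m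
      by auto
    then show ?thesis by (simp add: g_def)
  qed
  have "squarefree_coeff (p * q) C = (\<Sum>l. Poly_Mapping.lookup p l * g l)"
    by (simp add: lookup_mult g_def)
  also have "\<dots> = (\<Sum>l\<in>squarefree_monomial ` Pow C. Poly_Mapping.lookup p l * g l)"
    using assms g0 by (intro Sum_any.expand_superset) auto
  also have "\<dots> = (\<Sum>S\<in>Pow C. squarefree_coeff p S * squarefree_coeff q (C - S))"
    using inj g1 by (simp add: sum.reindex)
  finally show ?thesis .
qed

lemma squarefree_coeff_single:
  assumes "finite S" "finite T"
  shows "squarefree_coeff (Poly_Mapping.single (squarefree_monomial S) c) T = (if S = T then c else 0)"
  using assms by (simp add: lookup_single when_def squarefree_monomial_eq_iff)

lemma lookup_poly_const_mult: "Poly_Mapping.lookup (poly_const c * p) m = c * Poly_Mapping.lookup p m"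
  by (simp add: poly_const_def lookup_mult lookup_single when_mult)

lemma squarefree_coeff_homogeneous:
  assumes "homogeneous d p" "finite S" "card S \<noteq> d"
  shows "squarefree_coeff p S = 0"
proof (rule ccontr)
  assume "squarefree_coeff p S \<noteq> 0"
  then have "squarefree_monomial S \<in> Poly_Mapping.keys p" by (simp add: in_keys_iff)
  then have "(\<Sum>i\<in>S. Poly_Mapping.lookup (squarefree_monomial S) i) = d"
    using assms(1,2) by (metis homogeneous_def keys_squarefree_monomial)
  then show False using assms(2,3) by (simp add: lookup_squarefree_monomial)
qed

lemma homogeneous_add: "homogeneous d p \<Longrightarrow> homogeneous d q \<Longrightarrow> homogeneous d (p + q)"
  using keys_add[of p q] unfolding homogeneous_def by blast

lemma homogeneous_0: "homogeneous d 0"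
  by (simp add: homogeneous_def)

lemma homogeneous_sum: "(\<And>i. i \<in> I \<Longrightarrow> homogeneous d (f i)) \<Longrightarrow> homogeneous d (\<Sum>i\<in>I. f i)"
  by (induction I rule: infinite_finite_induct) (simp_all add: homogeneous_add homogeneous_0)

lemma homogeneous_poly_const_mult: "homogeneous d p \<Longrightarrow> homogeneous d (poly_const c * p)"
  by (auto simp: homogeneous_def in_keys_iff lookup_poly_const_mult)

lemma homogeneous_single_squarefree:
  "finite S \<Longrightarrow> card S = d \<Longrightarrow> homogeneous d (Poly_Mapping.single (squarefree_monomial S) c)"
  by (auto simp: homogeneous_def keys_squarefree_monomial lookup_squarefree_monomial)

section \<open>The polynomial ring in n variables\<close>

lemma poly_ring_simps [simp]:
  "mult (poly_ring n) = (*)" "one (poly_ring n) = 1"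
  "zero (poly_ring n) = 0" "add (poly_ring n) = (+)"
  by (simp_all add: poly_ring_def)

lemma carrier_poly_ring:
  "p \<in> carrier (poly_ring n) \<longleftrightarrow> (\<forall>m\<in>Poly_Mapping.keys p. Poly_Mapping.keys m \<subseteq> {1..n})"
  by (simp add: poly_ring_def)

lemma carrier_poly_ring_0 [simp]: "0 \<in> carrier (poly_ring n)"
  by (simp add: carrier_poly_ring)

lemma carrier_poly_ring_add [simp]:
  "p \<in> carrier (poly_ring n) \<Longrightarrow> q \<in> carrier (poly_ring n) \<Longrightarrow> p + q \<in> carrier (poly_ring n)"
  using keys_add[of p q] unfolding carrier_poly_ring by blast

lemma carrier_poly_ring_uminus [simp]:
  "p \<in> carrier (poly_ring n) \<Longrightarrow> - p \<in> carrier (poly_ring n)"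
  unfolding carrier_poly_ring by simp

lemma carrier_poly_ring_sum:
  "(\<And>i. i \<in> I \<Longrightarrow> f i \<in> carrier (poly_ring n)) \<Longrightarrow> (\<Sum>i\<in>I. f i) \<in> carrier (poly_ring n)"
  by (induction I rule: infinite_finite_induct) auto

lemma carrier_poly_ring_mult [simp]:
  assumes "p \<in> carrier (poly_ring n)" "q \<in> carrier (poly_ring n)"
  shows "p * q \<in> carrier (poly_ring n)"
  unfolding carrier_poly_ring
proof
  fix m assume "m \<in> Poly_Mapping.keys (p * q)"
  then obtain a b where "m = a + b" "a \<in> Poly_Mapping.keys p" "b \<in> Poly_Mapping.keys q"
    using keys_mult by blast
  then show "Poly_Mapping.keys m \<subseteq> {1..n}"
    using assms keys_add[of a b] unfolding carrier_poly_ring by blast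
qed

lemma carrier_poly_ring_single:
  "Poly_Mapping.keys m \<subseteq> {1..n} \<Longrightarrow> Poly_Mapping.single m c \<in> carrier (poly_ring n)"
  by (auto simp: carrier_poly_ring)

lemma carrier_poly_ring_const [simp]: "poly_const c \<in> carrier (poly_ring n)"
  by (simp add: poly_const_def carrier_poly_ring_single)

lemma cring_poly_ring: "cring (poly_ring n)"
proof (rule cringI)
  show "abelian_group (poly_ring n)"
  proof (rule abelian_groupI)
    fix p assume "p \<in> carrier (poly_ring n)"
    then show "\<exists>q\<in>carrier (poly_ring n). q \<oplus>\<^bsub>poly_ring n\<^esub> p = \<zero>\<^bsub>poly_ring n\<^esub>"
      by (intro bexI[of _ "- p"]) simp_all
  qed (simp_all add: algebra_simps)
  show "comm_monoid (poly_ring n)"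
  proof (rule comm_monoidI)
    show "\<one>\<^bsub>poly_ring n\<^esub> \<in> carrier (poly_ring n)" by (simp add: carrier_poly_ring)
  qed (simp_all add: algebra_simps)
qed (simp add: algebra_simps)

lemma a_minus_poly_ring:
  assumes "p \<in> carrier (poly_ring n)" "q \<in> carrier (poly_ring n)"
  shows "p \<ominus>\<^bsub>poly_ring n\<^esub> q = p - q"
proof -
  interpret cring "poly_ring n" by (rule cring_poly_ring)
  have "\<ominus>\<^bsub>poly_ring n\<^esub> q = - q" using assms by (intro minus_equality) simp_all
  then show ?thesis by (simp add: a_minus_def)
qed

section \<open>The ideal of squares described by coefficients\<close>

lemma squarefree_coeff_kernel_ideal:
  "ideal {p \<in> carrier (poly_ring n). \<forall>S\<subseteq>{1..n}. squarefree_coeff p S = 0} (poly_ring n)"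
    (is "ideal ?J _")
proof -
  interpret cring "poly_ring n" by (rule cring_poly_ring)
  have mult: "squarefree_coeff (p * q) S = 0"
    if "\<forall>S\<subseteq>{1..n}. squarefree_coeff p S = 0" "S \<subseteq> {1..n}" for p q S
  proof -
    have "finite S" using that finite_subset by blast
    then show ?thesis using that by (subst squarefree_coeff_mult) (auto intro!: sum.neutral)
  qed
  show ?thesis
  proof (rule idealI)
    show "subgroup ?J (add_monoid (poly_ring n))"
    proof (rule add.subgroupI)
      fix p assume p: "p \<in> ?J"
      then have "\<ominus>\<^bsub>poly_ring n\<^esub> p = - p" by (intro minus_equality) simp_all
      with p show "\<ominus>\<^bsub>poly_ring n\<^esub> p \<in> ?J" by simp
    qed (auto simp: lookup_add intro!: exI[of _ 0])
  next
    fix p q assume "p \<in> ?J" "q \<in> carrier (poly_ring n)"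
    then show "p \<otimes>\<^bsub>poly_ring n\<^esub> q \<in> ?J" by (auto simp: mult)
    then show "q \<otimes>\<^bsub>poly_ring n\<^esub> p \<in> ?J" by (simp add: mult.commute)
  qed (rule ring_axioms)
qed

text \<open>Membership in the generated ideal becomes a test on coefficients. The generators contain
  no squarefree monomial; conversely, each monomial of a polynomial in the kernel has some exponent
  at least 2 and is a multiple of a generator.\<close>

lemma square_ideal_eq:
  "square_ideal n = {p \<in> carrier (poly_ring n). \<forall>S\<subseteq>{1..n}. squarefree_coeff p S = 0}"
    (is "_ = ?J")
proof
  interpret cring "poly_ring n" by (rule cring_poly_ring)
  have var: "poly_var i ^ 2 = Poly_Mapping.single (Poly_Mapping.single i 2) 1" for i
    by (simp only: poly_var_def power2_eq_square mult_single one_add_one mult_1 flip: single_add)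
  have gens: "(\<lambda>i. poly_var i ^ 2) ` {1..n} \<subseteq> carrier (poly_ring n)"
    by (auto simp: var intro!: carrier_poly_ring_single)
  show "square_ideal n \<subseteq> ?J"
    unfolding square_ideal_def
  proof (rule genideal_minimal[OF squarefree_coeff_kernel_ideal], rule image_subsetI)
    fix i assume i: "i \<in> {1..n}"
    have "Poly_Mapping.single i 2 \<noteq> squarefree_monomial S" if "S \<subseteq> {1..n}" for S
    proof
      assume "Poly_Mapping.single i 2 = squarefree_monomial S"
      then have "2 = Poly_Mapping.lookup (squarefree_monomial S) i" by (metis lookup_single_eq)
      moreover have "finite S" using that finite_subset by blast
      ultimately show False by (simp add: lookup_squarefree_monomial split: if_splits)
    qed
    with i gens show "poly_var i ^ 2 \<in> ?J" by (auto simp: var lookup_single when_def)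
  qed
  show "?J \<subseteq> square_ideal n"
  proof
    fix p assume p: "p \<in> ?J"
    interpret I: ideal "square_ideal n" "poly_ring n"
      unfolding square_ideal_def using gens by (rule genideal_ideal)
    have term_mem: "Poly_Mapping.single m c \<in> square_ideal n" if m: "m \<in> Poly_Mapping.keys p" for m c
    proof -
      have km: "Poly_Mapping.keys m \<subseteq> {1..n}" using p m by (simp add: carrier_poly_ring)
      \<comment> \<open>Otherwise the coefficient at \<open>m\<close> would vanish, although
        \<open>m\<close> is a key of \<open>p\<close>.\<close>
      have "m \<noteq> squarefree_monomial (Poly_Mapping.keys m)"
        using p m km by (auto simp: in_keys_iff)
      then obtain i where i: "Poly_Mapping.lookup m i > 1"
        using squarefree_monomialI[of m] by (meson not_le)
      then have "i \<in> Poly_Mapping.keys m" by (simp add: in_keys_iff)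
      with km have i_n: "i \<in> {1..n}" by blast
      \<comment> \<open>Subtraction of exponents is truncated; the exponent of \<open>i\<close>
        being at least 2 makes this the true cofactor.\<close>
      define m' where "m' = m - Poly_Mapping.single i 2"
      have m': "m = m' + Poly_Mapping.single i 2"
        using i by (intro poly_mapping_eqI) (auto simp: m'_def lookup_add lookup_minus lookup_single when_def)
      have "Poly_Mapping.keys m' \<subseteq> Poly_Mapping.keys m"
        by (auto simp: m'_def in_keys_iff lookup_minus)
      then have "Poly_Mapping.single m' c \<in> carrier (poly_ring n)"
        using km by (intro carrier_poly_ring_single) blast
      moreover have "poly_var i ^ 2 \<in> square_ideal n"
        unfolding square_ideal_def using i_n genideal_self[OF gens] by blast
      ultimately have "Poly_Mapping.single m' c * poly_var i ^ 2 \<in> square_ideal n"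
        using I.I_l_closed[of "poly_var i ^ 2" "Poly_Mapping.single m' c"] by simp
      then show ?thesis by (simp add: var m' mult_single)
    qed
    have "(\<Sum>m\<in>M. Poly_Mapping.single m (Poly_Mapping.lookup p m)) \<in> square_ideal n"
      if "finite M" "M \<subseteq> Poly_Mapping.keys p" for M
      using that
    proof (induction M)
      case empty
      then show ?case using I.zero_closed by simp
    next
      case (insert m M)
      then show ?case
        using I.a_closed[of "Poly_Mapping.single m (Poly_Mapping.lookup p m)"] term_mem by simp
    qed
    moreover have "p = (\<Sum>m\<in>Poly_Mapping.keys p. Poly_Mapping.single m (Poly_Mapping.lookup p m))"
      by (rule poly_mapping_eqI) (simp add: lookup_sum lookup_single when_def in_keys_iff)
    ultimately show "p \<in> square_ideal n" by (metis finite_keys order_refl)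
  qed
qed

lemma ideal_square_ideal: "ideal (square_ideal n) (poly_ring n)"
  unfolding square_ideal_eq by (rule squarefree_coeff_kernel_ideal)

section \<open>The quotient algebra, its graded pieces and coefficient functionals\<close>

definition residue_class :: "nat \<Rightarrow> cpoly \<Rightarrow> cpoly set" where
  "residue_class n p = square_ideal n +>\<^bsub>poly_ring n\<^esub> p"

lemma residue_class_eq_iff:
  assumes "p \<in> carrier (poly_ring n)" "q \<in> carrier (poly_ring n)"
  shows "residue_class n p = residue_class n q \<longleftrightarrow> (\<forall>S\<subseteq>{1..n}. squarefree_coeff p S = squarefree_coeff q S)"
proof -
  interpret cring "poly_ring n" by (rule cring_poly_ring)
  have "p - q \<in> carrier (poly_ring n)"
    using carrier_poly_ring_add[OF assms(1) carrier_poly_ring_uminus[OF assms(2)]] by simp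
  then show ?thesis
    using quotient_eq_iff_same_a_r_cos[OF ideal_square_ideal assms] a_minus_poly_ring[OF assms]
    by (simp add: residue_class_def square_ideal_eq lookup_minus)
qed

lemma carrier_graded_piece:
  "carrier (graded_piece n d) = {residue_class n p |p. p \<in> carrier (poly_ring n) \<and> homogeneous d p}"
  by (simp add: graded_piece_def residue_class_def)

lemma tensor_power_B_mult:
  assumes "p \<in> carrier (poly_ring n)" "q \<in> carrier (poly_ring n)"
  shows "residue_class n p \<otimes>\<^bsub>tensor_power_B n\<^esub> residue_class n q = residue_class n (p * q)"
  using ideal.rcoset_mult_add[OF ideal_square_ideal assms]
  by (simp add: tensor_power_B_def residue_class_def FactRing_def ring.defs Let_def)

lemma graded_piece_add:
  assumes "p \<in> carrier (poly_ring n)" "q \<in> carrier (poly_ring n)"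
  shows "residue_class n p \<oplus>\<^bsub>graded_piece n d\<^esub> residue_class n q = residue_class n (p + q)"
  using ideal.a_rcos_sum[OF ideal_square_ideal assms]
  by (simp add: graded_piece_def tensor_power_B_def residue_class_def FactRing_def ring.defs Let_def)

lemma graded_piece_smult:
  assumes "p \<in> carrier (poly_ring n)"
  shows "c \<odot>\<^bsub>graded_piece n d\<^esub> residue_class n p = residue_class n (poly_const c * p)"
  using ideal.rcoset_mult_add[OF ideal_square_ideal carrier_poly_ring_const assms, of c]
  by (simp add: graded_piece_def tensor_power_B_def residue_class_def FactRing_def
      ring.defs module.defs Let_def)

lemma graded_piece_zero: "\<zero>\<^bsub>graded_piece n d\<^esub> = residue_class n 0"
proof -
  interpret cring "poly_ring n" by (rule cring_poly_ring)
  interpret ideal "square_ideal n" "poly_ring n" by (rule ideal_square_ideal)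
  have "square_ideal n +>\<^bsub>poly_ring n\<^esub> \<zero>\<^bsub>poly_ring n\<^esub> = square_ideal n"
    by (rule a_coset_join2[OF _ a_subgroup zero_closed]) simp
  then show ?thesis
    by (simp add: graded_piece_def tensor_power_B_def residue_class_def FactRing_def ring.defs Let_def)
qed

text \<open>Supplies the laws by which \<open>finsum\<close>, the sum in a tensor decomposition, is
  evaluated.\<close>

lemma abelian_monoid_graded_piece: "abelian_monoid (graded_piece n d)"
proof (rule abelian_monoidI)
  show "\<zero>\<^bsub>graded_piece n d\<^esub> \<in> carrier (graded_piece n d)"
    unfolding carrier_graded_piece graded_piece_zero using homogeneous_0 by auto
next
  fix X Y assume "X \<in> carrier (graded_piece n d)" "Y \<in> carrier (graded_piece n d)"
  then show "X \<oplus>\<^bsub>graded_piece n d\<^esub> Y \<in> carrier (graded_piece n d)"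
    using homogeneous_add carrier_poly_ring_add by (fastforce simp: carrier_graded_piece graded_piece_add)
qed (auto simp: carrier_graded_piece graded_piece_add graded_piece_zero add_ac)

lemma finsum_graded_piece:
  assumes "finite J" "\<And>j. j \<in> J \<Longrightarrow> p j \<in> carrier (poly_ring n) \<and> homogeneous d (p j)"
  shows "(\<Oplus>\<^bsub>graded_piece n d\<^esub>j\<in>J. residue_class n (p j)) = residue_class n (\<Sum>j\<in>J. p j)"
proof -
  interpret abelian_monoid "graded_piece n d" by (rule abelian_monoid_graded_piece)
  show ?thesis
    using assms
  proof (induction J)
    case empty
    then show ?case by (simp add: graded_piece_zero)
  next
    case (insert j J)
    then have "residue_class n (p i) \<in> carrier (graded_piece n d)" if "i \<in> insert j J" for i
      unfolding carrier_graded_piece using that by blast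
    with insert show ?case by (simp add: graded_piece_add carrier_poly_ring_sum Pi_def)
  qed
qed

text \<open>The representative is arbitrary: by \<open>residue_class_eq_iff\<close> the coefficients
  at subsets of {1..n} are the same for all representatives.\<close>

definition class_coeff :: "nat \<Rightarrow> cpoly set \<Rightarrow> nat set \<Rightarrow> complex" where
  "class_coeff n X = squarefree_coeff (SOME p. p \<in> carrier (poly_ring n) \<and> residue_class n p = X)"

lemma class_coeff_residue_class:
  assumes "p \<in> carrier (poly_ring n)" "S \<subseteq> {1..n}"
  shows "class_coeff n (residue_class n p) S = squarefree_coeff p S"
proof -
  define q where "q = (SOME q. q \<in> carrier (poly_ring n) \<and> residue_class n q = residue_class n p)"
  have "q \<in> carrier (poly_ring n) \<and> residue_class n q = residue_class n p"
    unfolding q_def by (rule someI[of _ p]) (simp add: assms)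
  then show ?thesis
    using assms residue_class_eq_iff[of q n p] by (simp add: class_coeff_def flip: q_def)
qed

lemma linear_form_class_coeff_sum:
  assumes "\<A> \<subseteq> Pow {1..n}"
  shows "linear_form (graded_piece n d) (\<lambda>X. \<Sum>S\<in>\<A>. a S * class_coeff n X S)"
proof -
  have coeff: "(\<Sum>S\<in>\<A>. a S * class_coeff n (residue_class n p) S) = (\<Sum>S\<in>\<A>. a S * squarefree_coeff p S)"
    if "p \<in> carrier (poly_ring n)" for p
    using that assms by (intro sum.cong refl) (auto simp: class_coeff_residue_class)
  show ?thesis
    unfolding linear_form_def carrier_graded_piece
    by (auto simp: graded_piece_add graded_piece_smult coeff lookup_add lookup_poly_const_mult
        distrib_left sum.distrib mult.left_commute simp flip: sum_distrib_left)
qed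

section \<open>Comparison of the group algebra with the squarefree product\<close>

text \<open>The symmetric difference has |S| + |T| - 2|S \<inter> T| elements, so the cardinality
  hypothesis forces \<open>S\<close> and \<open>T\<close> to be disjoint.\<close>

lemma sym_diff_eq_iff:
  assumes "finite S" "finite T" "card C = card S + card T"
  shows "sym_diff S T = C \<longleftrightarrow> S \<subseteq> C \<and> T = C - S"
proof
  assume C: "sym_diff S T = C"
  have "card C = card (S - T) + card (T - S)"
    unfolding C[symmetric] using assms by (intro card_Un_disjoint) auto
  then have "card (S \<inter> T) = 0"
    using assms(3) card_Int_Diff[OF assms(1), of T] card_Int_Diff[OF assms(2), of S]
    unfolding Int_commute[of T S] by linarith
  then have "S \<inter> T = {}" using assms by simp
  then show "S \<subseteq> C \<and> T = C - S" using C by auto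
qed auto

text \<open>On the left, two group algebra elements are evaluated at the characters
  \<open>e j\<close>, the values are multiplied, and the weights extract the coefficient of the
  product at \<open>C\<close>. Only pairs with symmetric difference \<open>C\<close> survive, and
  these are the splittings of \<open>C\<close> that form the squarefree product.\<close>

lemma sum_characters_eq_squarefree_product:
  fixes p q w :: "nat set \<Rightarrow> complex" and e :: "nat \<Rightarrow> nat set"
  assumes ext: "\<And>A B. A \<in> even_subsets n k \<Longrightarrow> B \<in> even_subsets n k \<Longrightarrow>
      (\<Sum>j<r. character A (e j) * v j B) = (if A = B then 1 else 0)"
    and C: "C \<subseteq> {1..n}" "card C = 2 * k"
    and p: "\<And>S. S \<subseteq> {1..n} \<Longrightarrow> card S \<noteq> k \<Longrightarrow> p S = 0"
    and \<A>: "\<A> = {S. S \<subseteq> {1..n} \<and> card S = k}"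
  shows "(\<Sum>j<r. (\<Sum>S\<in>\<A>. character S (e j) * p S) * (\<Sum>T\<in>\<A>. character T (e j) * q T) * v j C)
    = (\<Sum>S\<in>Pow C. p S * q (C - S))"
proof -
  have fin: "finite \<A>" unfolding \<A> by (rule finite_subset[of _ "Pow {1..n}"]) auto
  have fC: "finite C" using C(1) finite_subset by blast
  have "(\<Sum>j<r. (\<Sum>S\<in>\<A>. character S (e j) * p S) * (\<Sum>T\<in>\<A>. character T (e j) * q T) * v j C)
    = (\<Sum>j<r. \<Sum>S\<in>\<A>. \<Sum>T\<in>\<A>. p S * q T * (character (sym_diff S T) (e j) * v j C))"
    unfolding sum_product
    unfolding sum_distrib_right character_mult[symmetric] by (simp only: mult_ac)
  also have "\<dots> = (\<Sum>S\<in>\<A>. \<Sum>T\<in>\<A>. p S * q T * (\<Sum>j<r. character (sym_diff S T) (e j) * v j C))"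
    by (subst sum.swap, intro sum.cong refl, subst sum.swap) (simp add: sum_distrib_left)
  also have "\<dots> = (\<Sum>S\<in>\<A>. \<Sum>T\<in>\<A>. if T = C - S \<and> S \<subseteq> C then p S * q T else 0)"
  proof (intro sum.cong refl)
    fix S T assume "S \<in> \<A>" "T \<in> \<A>"
    then have ST: "S \<subseteq> {1..n}" "T \<subseteq> {1..n}" "card S = k" "card T = k" by (auto simp: \<A>)
    then have f: "finite S" "finite T" using finite_subset by blast+
    \<comment> \<open>The size equals 2k - 2|S \<inter> T|, hence is even and at most 2k, so that
      \<open>ext\<close> applies.\<close>
    have "card (sym_diff S T) = card (S - T) + card (T - S)"
      using f by (intro card_Un_disjoint) auto
    then have "card (sym_diff S T) + 2 * card (S \<inter> T) = 2 * k"
      using ST(3,4) card_Int_Diff[OF f(1), of T] card_Int_Diff[OF f(2), of S]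
      unfolding Int_commute[of T S] by linarith
    then have "even (card (sym_diff S T))" "card (sym_diff S T) \<le> 2 * k" by presburger+
    then have "sym_diff S T \<in> even_subsets n k"
      using ST by (auto simp: even_subsets_def)
    moreover have "C \<in> even_subsets n k" using C by (simp add: even_subsets_def)
    ultimately show "p S * q T * (\<Sum>j<r. character (sym_diff S T) (e j) * v j C)
        = (if T = C - S \<and> S \<subseteq> C then p S * q T else 0)"
      using ext sym_diff_eq_iff[OF f, of C] ST C by auto
  qed
  also have "\<dots> = (\<Sum>S\<in>\<A>. if S \<subseteq> C then p S * q (C - S) else 0)"
  proof (intro sum.cong refl)
    fix S assume S: "S \<in> \<A>"
    \<comment> \<open>The complement has 2k - k = k elements, so the inner sum has a term at
      \<open>T = C - S\<close>.\<close>
    have "C - S \<in> \<A>" if "S \<subseteq> C"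
      using that S C fC finite_subset[OF that fC] by (auto simp: \<A> card_Diff_subset)
    then show "(\<Sum>T\<in>\<A>. if T = C - S \<and> S \<subseteq> C then p S * q T else 0)
        = (if S \<subseteq> C then p S * q (C - S) else 0)"
      using fin by auto
  qed
  also have "\<dots> = (\<Sum>S\<in>{S \<in> \<A>. S \<subseteq> C}. p S * q (C - S))"
    using fin by (simp add: sum.inter_filter)
  \<comment> \<open>Subsets of \<open>C\<close> whose size is not \<open>k\<close> may be added
    because \<open>p\<close> vanishes on them.\<close>
  also have "\<dots> = (\<Sum>S\<in>Pow C. p S * q (C - S))"
    using fC C p by (intro sum.mono_neutral_left) (auto simp: \<A>)
  finally show ?thesis .
qed

section \<open>The decomposition and the rank bound\<close>

theorem tensor_rank_squarefree_mult:
  "tensor_rank (graded_piece n k) (graded_piece n k) (graded_piece n (2 * k))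
     (\<lambda>x y. x \<otimes>\<^bsub>tensor_power_B n\<^esub> y) \<le> enat (\<Sum>i\<le>k. n choose (2 * i))"
proof -
  obtain r e v where r: "r \<le> (\<Sum>i\<le>k. n choose (2 * i))"
    and ext: "\<And>A B. A \<in> even_subsets n k \<Longrightarrow> B \<in> even_subsets n k \<Longrightarrow>
        (\<Sum>j<r. character A (e j) * v j B) = (if A = B then 1 else 0)"
    using coefficient_extraction[of n k] by blast
  define \<A> where "\<A> = {S. S \<subseteq> {1..n} \<and> card S = k}"
  define \<C> where "\<C> = {C. C \<subseteq> {1..n} \<and> card C = 2 * k}"
  \<comment> \<open>Evaluation of the lift of \<open>X\<close> to the group algebra at the character
    \<open>e j\<close>; the same form serves both factors.\<close>
  define u where "u j X = (\<Sum>S\<in>\<A>. character S (e j) * class_coeff n X S)" for j X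
  \<comment> \<open>Collects the extraction weights of all degree 2k coefficients in one
    vector.\<close>
  define w where "w j = (\<Sum>C\<in>\<C>. Poly_Mapping.single (squarefree_monomial C) (v j C))" for j
  have fin\<C>: "finite \<C>" unfolding \<C>_def by (rule finite_subset[of _ "Pow {1..n}"]) auto
  have finI: "finite C" if "C \<subseteq> {1..n}" for C :: "nat set" using that finite_subset by blast
  have \<C>: "C \<subseteq> {1..n}" "finite C" "card C = 2 * k" if "C \<in> \<C>" for C
    using that finI by (auto simp only: \<C>_def)
  have w: "w j \<in> carrier (poly_ring n)" "homogeneous (2 * k) (w j)" for j
    unfolding w_def
    by (intro carrier_poly_ring_sum carrier_poly_ring_single)
      (simp only: keys_squarefree_monomial \<C>,
       intro homogeneous_sum homogeneous_single_squarefree \<C>)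
  have w_coeff: "squarefree_coeff (w j) C = (if card C = 2 * k then v j C else 0)"
    if "C \<subseteq> {1..n}" for j C
  proof -
    have "squarefree_coeff (w j) C = (\<Sum>D\<in>\<C>. if D = C then v j D else 0)"
      unfolding w_def lookup_sum using that
      by (intro sum.cong refl squarefree_coeff_single) (auto simp: \<C>_def finI)
    then show ?thesis using that fin\<C> by (auto simp: \<C>_def)
  qed
  have "is_tensor_decomposition (graded_piece n k) (graded_piece n k) (graded_piece n (2 * k))
      (\<lambda>x y. x \<otimes>\<^bsub>tensor_power_B n\<^esub> y) r u u (\<lambda>j. residue_class n (w j))"
    unfolding is_tensor_decomposition_def
  proof (intro conjI allI impI ballI)
    fix j
    show "linear_form (graded_piece n k) (u j)" unfolding u_def
      by (rule linear_form_class_coeff_sum) (auto simp: \<A>_def)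
    then show "linear_form (graded_piece n k) (u j)" .
    show "residue_class n (w j) \<in> carrier (graded_piece n (2 * k))"
      using w by (auto simp: carrier_graded_piece)
  next
    fix X Y assume "X \<in> carrier (graded_piece n k)" "Y \<in> carrier (graded_piece n k)"
    then obtain p q where p: "p \<in> carrier (poly_ring n)" "homogeneous k p" "X = residue_class n p"
      and q: "q \<in> carrier (poly_ring n)" "homogeneous k q" "Y = residue_class n q"
      by (auto simp: carrier_graded_piece)
    \<comment> \<open>A polynomial representing the value of the decomposition at \<open>X\<close>
      and \<open>Y\<close>; the claim reduces to comparing its squarefree coefficients with those of
      \<open>p * q\<close>.\<close>
    define s where "s = (\<Sum>j<r. poly_const (u j X * u j Y) * w j)"
    have s: "s \<in> carrier (poly_ring n)"
      unfolding s_def using w by (intro carrier_poly_ring_sum) simp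
    have u_eq: "u j (residue_class n p) = (\<Sum>S\<in>\<A>. character S (e j) * squarefree_coeff p S)"
      if "p \<in> carrier (poly_ring n)" for j p
      unfolding u_def using that by (intro sum.cong refl) (auto simp: class_coeff_residue_class \<A>_def)
    have "squarefree_coeff (p * q) C = squarefree_coeff s C" if C: "C \<subseteq> {1..n}" for C
    proof -
      have pq: "squarefree_coeff (p * q) C
          = (\<Sum>S\<in>Pow C. squarefree_coeff p S * squarefree_coeff q (C - S))"
        by (rule squarefree_coeff_mult[OF finI[OF C]])
      have sC: "squarefree_coeff s C = (\<Sum>j<r. u j X * u j Y * squarefree_coeff (w j) C)"
        by (simp add: s_def lookup_sum lookup_poly_const_mult)
      show ?thesis
      proof (cases "card C = 2 * k")
        case True
        have "squarefree_coeff s C = (\<Sum>j<r. (\<Sum>S\<in>\<A>. character S (e j) * squarefree_coeff p S) *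
            (\<Sum>T\<in>\<A>. character T (e j) * squarefree_coeff q T) * v j C)"
          using True C by (simp add: sC w_coeff p(3) q(3) u_eq p(1) q(1))
        also have "\<dots> = (\<Sum>S\<in>Pow C. squarefree_coeff p S * squarefree_coeff q (C - S))"
          by (rule sum_characters_eq_squarefree_product[OF ext C True _ \<A>_def])
            (auto simp: squarefree_coeff_homogeneous[OF p(2)] finI)
        finally show ?thesis using pq by simp
      next
        \<comment> \<open>Outside degree 2k both coefficients vanish: that of \<open>p * q\<close>
          by homogeneity of the factors, that of \<open>s\<close> because \<open>w j\<close> lives
          on \<open>\<C>\<close>.\<close>
        case False
        have "squarefree_coeff (p * q) C = 0"
          unfolding pq
        proof (intro sum.neutral ballI)
          fix S assume "S \<in> Pow C"
          then have "S \<subseteq> C" "finite S" "card C = card S + card (C - S)"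
            using finI[OF C] by (auto simp: card_Diff_subset card_mono finite_subset)
          then have "card S \<noteq> k \<or> card (C - S) \<noteq> k" using False by auto
          then show "squarefree_coeff p S * squarefree_coeff q (C - S) = 0"
            using squarefree_coeff_homogeneous[OF p(2) \<open>finite S\<close>]
              squarefree_coeff_homogeneous[OF q(2), of "C - S"] finI[OF C] by auto
        qed
        moreover have "squarefree_coeff s C = 0" using False C by (simp add: sC w_coeff)
        ultimately show ?thesis by simp
      qed
    qed
    then have "residue_class n (p * q) = residue_class n s"
      using residue_class_eq_iff[of "p * q" n s] p q s by simp
    moreover have "(\<Oplus>\<^bsub>graded_piece n (2 * k)\<^esub>j\<in>{..<r}.
        simple_tensor (graded_piece n (2 * k)) (u j) (u j) (residue_class n (w j)) X Y) = residue_class n s"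
      unfolding s_def simple_tensor_def
      using w by (simp add: graded_piece_smult finsum_graded_piece homogeneous_poly_const_mult)
    ultimately show "X \<otimes>\<^bsub>tensor_power_B n\<^esub> Y = (\<Oplus>\<^bsub>graded_piece n (2 * k)\<^esub>j\<in>{..<r}.
        simple_tensor (graded_piece n (2 * k)) (u j) (u j) (residue_class n (w j)) X Y)"
      using p q by (simp add: tensor_power_B_mult)
  qed
  then have "tensor_rank (graded_piece n k) (graded_piece n k) (graded_piece n (2 * k))
     (\<lambda>x y. x \<otimes>\<^bsub>tensor_power_B n\<^esub> y) \<le> enat r"
    unfolding tensor_rank_def by (intro Inf_lower) blast
  also have "enat r \<le> enat (\<Sum>i\<le>k. n choose (2 * i))" using r by simp
  finally show ?thesis .
qed

text \<open>The case n = 3k, with the count rewritten by \<open>sum_choose_even\<close>. The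
  comparison is made in \<open>ereal\<close> because the rank is a possibly infinite natural number
  and the bound is a real difference.\<close>

theorem proposition1p19:
  fixes k :: nat
  assumes "k \<ge> 1"
  shows "ereal_of_enat
           (tensor_rank (graded_piece (3 * k) k) (graded_piece (3 * k) k) (graded_piece (3 * k) (2 * k))
              (\<lambda>x y. x \<otimes>\<^bsub>tensor_power_B (3 * k)\<^esub> y))
         \<le> ereal (1 / 2 * 8 ^ k - (\<Sum>i = k + 1..(3 * k) div 2. real ((3 * k) choose (2 * i))))"
proof -
  have "ereal_of_enat
           (tensor_rank (graded_piece (3 * k) k) (graded_piece (3 * k) k) (graded_piece (3 * k) (2 * k))
              (\<lambda>x y. x \<otimes>\<^bsub>tensor_power_B (3 * k)\<^esub> y))
      \<le> ereal_of_enat (enat (\<Sum>i\<le>k. (3 * k) choose (2 * i)))"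
    unfolding ereal_of_enat_le_iff by (rule tensor_rank_squarefree_mult)
  also have "\<dots> = ereal (real (\<Sum>i\<le>k. (3 * k) choose (2 * i)))"
    by (rule ereal_of_enat_simps(1))
  finally show ?thesis
    unfolding sum_choose_even[OF assms] .
qed

end
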